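(* Let $$H := \{123, 124, 125, 126, 127, 134, 135, 136, 145, 146, 156\} \subseteq [7]^{(3)}$$ (where $abc$ denotes $\{a,b,c\}$), a $3$-graph with $11$ edges. Then $P_2(H) = 211$, while $P_2(L) \le 209$ both when $L$ is the lex $3$-graph $\mathcal{L}(11,7,3)$ and when $L$ is the complement in $[7]^{(3)}$ of the lex $3$-graph $\mathcal{L}(24,7,3)$ (so that $|L|=11$); in particular $P_2(\mathcal{C}(11,3)) \le 209$. Consequently, it is not the case that for every $r, m, t$ one of $\mathcal{L}(m,t,r)$ and $\mathcal{C}(m,r)$ attains the maximum of $P_2$ over all $r$-graphs contained in $[t]^{(r)}$ with $m$ edges.
   Context: $[t] = \{1,\dots,t\}$, and $X^{(r)}$ denotes the family of all $r$-element subsets of $X$. An $r$-graph is a finite family of $r$-element subsets of $\mathbb{N} = \{1,2,\dots\}$, whose members are its edges. For an $r$-graph $F$, $P_2(F) := \sum_x d(x)^2$, where $d(x)$ is the number of edges of $F$ containing $x$. For distinct $A, B \in [t]^{(r)}$, $A <_{\mathrm{lex}} B$ if and only if $\min(A \triangle B) \in A$; $\mathcal{L}(m,t,r)$ is the family of the first $m$ sets of $[t]^{(r)}$ in this order. The colexicographic order on $\mathbb{N}^{(r)}$ is: $A < B$ if and only if $\sum_{i\in A} 2^i < \sum_{i \in B} 2^i$; $\mathcal{C}(m,r)$ is the family of the first $m$ sets of $\mathbb{N}^{(r)}$ in this order. *)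

theory Defs
  imports "HOL-Library.Ramsey"
begin

text \<open>
  The family of all \<open>r\<close>-element subsets of \<open>X\<close> is \<^const>\<open>nsets\<close> \<open>X r\<close>. The vertex set is
  \<open>{1,2,...}\<close>, i.e. \<open>{1..} :: nat set\<close>.
\<close>

definition rgraph :: "nat \<Rightarrow> nat set set \<Rightarrow> bool" where
  "rgraph r F \<longleftrightarrow> finite F \<and> F \<subseteq> nsets {1..} r"

definition deg :: "nat set set \<Rightarrow> nat \<Rightarrow> nat" where
  "deg F x = card {e \<in> F. x \<in> e}"

text \<open>Vertices outside \<open>\<Union>F\<close> have degree 0, so summing over \<open>\<Union>F\<close> sums over all vertices.\<close>

definition P2 :: "nat set set \<Rightarrow> nat" where
  "P2 F = (\<Sum>x\<in>\<Union>F. (deg F x)\<^sup>2)"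

definition lex_less :: "nat set \<Rightarrow> nat set \<Rightarrow> bool" where
  "lex_less A B \<longleftrightarrow> A \<noteq> B \<and> Min ((A - B) \<union> (B - A)) \<in> A"

definition colex_less :: "nat set \<Rightarrow> nat set \<Rightarrow> bool" where
  "colex_less A B \<longleftrightarrow> (\<Sum>i\<in>A. (2::nat) ^ i) < (\<Sum>i\<in>B. 2 ^ i)"

text \<open>
  The first \<open>m\<close> elements of \<open>X\<close> in the strict order \<open>lt\<close> are those with fewer than \<open>m\<close>
  predecessors. This needs every element to have finitely many predecessors in \<open>X\<close>
  (\<^const>\<open>card\<close> of an infinite set is 0), which holds in both uses below. If \<open>X\<close> has
  fewer than \<open>m\<close> elements, the result is all of \<open>X\<close>.
\<close>

definition first_sets :: "('a \<Rightarrow> 'a \<Rightarrow> bool) \<Rightarrow> 'a set \<Rightarrow> nat \<Rightarrow> 'a set" where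
  "first_sets lt X m = {A \<in> X. card {B \<in> X. lt B A} < m}"

definition lex_family :: "nat \<Rightarrow> nat \<Rightarrow> nat \<Rightarrow> nat set set" where
  "lex_family m t r = first_sets lex_less (nsets {1..t} r) m"

definition colex_family :: "nat \<Rightarrow> nat \<Rightarrow> nat set set" where
  "colex_family m r = first_sets colex_less (nsets {1..} r) m"

definition H :: "nat set set" where
  "H = {{1,2,3}, {1,2,4}, {1,2,5}, {1,2,6}, {1,2,7}, {1,3,4}, {1,3,5}, {1,3,6},
        {1,4,5}, {1,4,6}, {1,5,6}}"

end

theory Submission
  imports Defs
begin

text \<open>
  Encode a 3-set as its increasing triple, so that lex on sets becomes lex on triples and all
  degree sums are finite computations; the degree sequences are
  11,5,4,4,4,4,1 for \<^const>\<open>H\<close>, 11,5,5,4,3,3,2 for the lex 3-graph, and 0,1,6,6,6,7,7 for the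
  complement. The colex 3-graph consists of the triples in \<open>{1,...,5}\<close> and \<open>126\<close>; these are the
  triples of binary weight at most \<open>70 = 2^1 + 2^2 + 2^6\<close>. Since \<^const>\<open>H\<close> beats both
  families, \<open>r = 3\<close>, \<open>m = 11\<close>, \<open>t = 7\<close> is a counterexample to the maximality claim.
\<close>

section \<open>Initial segments of a relation\<close>

lemma first_sets_eqI:
  assumes "F \<subseteq> X" "finite F" "card F = m"
    and irrefl: "\<And>A. A \<in> F \<Longrightarrow> \<not> lt A A"
    and below: "\<And>A C. A \<in> F \<Longrightarrow> C \<in> X - F \<Longrightarrow> lt A C \<and> \<not> lt C A"
    and fin: "\<And>C. C \<in> X - F \<Longrightarrow> finite {B \<in> X. lt B C}"
  shows "first_sets lt X m = F"
proof -
  have "card {B \<in> X. lt B A} < m" if "A \<in> F" for A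
  proof -
    \<comment> \<open>Nothing outside \<open>F\<close> precedes \<open>A\<close>, and
      \<open>A\<close> does not precede itself; the inclusion is strict because \<open>A\<close> is
      missing on the left.\<close>
    have "{B \<in> X. lt B A} \<subset> F"
      using that irrefl below by blast
    then show ?thesis
      using assms(2,3) psubset_card_mono by blast
  qed
  moreover have "m \<le> card {B \<in> X. lt B C}" if "C \<in> X - F" for C
  proof -
    \<comment> \<open>All \<open>m\<close> members of \<open>F\<close> precede \<open>C\<close>.
      Finiteness of the predecessor set matters here, since otherwise its \<open>card\<close> would
      be 0.\<close>
    have "F \<subseteq> {B \<in> X. lt B C}"
      using that below assms(1) by blast
    then show ?thesis
      using assms(3) card_mono fin[OF that] by blast
  qed
  ultimately show ?thesis
    using assms(1) unfolding first_sets_def by fastforce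
qed

text \<open>Splitting a sorted list after \<open>m\<close> entries puts every entry of the prefix
  below every later one; asymmetry excludes the reverse relation, so the prefix is an initial
  segment.\<close>

lemma first_sets_sorted:
  assumes "sorted_wrt lt xs" "distinct xs" "m \<le> length xs"
    and irrefl: "\<And>A. A \<in> set xs \<Longrightarrow> \<not> lt A A"
    and asym: "\<And>A B. A \<in> set xs \<Longrightarrow> B \<in> set xs \<Longrightarrow> lt A B \<Longrightarrow> \<not> lt B A"
  shows "first_sets lt (set xs) m = set (take m xs)"
proof (rule first_sets_eqI)
  have "sorted_wrt lt (take m xs @ drop m xs)"
    using assms(1) by simp
  then have *: "lt A C" if "A \<in> set (take m xs)" "C \<in> set (drop m xs)" for A C
    using that by (auto simp only: sorted_wrt_append)
  have X: "set xs = set (take m xs) \<union> set (drop m xs)"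
    by (metis append_take_drop_id set_append)
  show "lt A C \<and> \<not> lt C A" if "A \<in> set (take m xs)" "C \<in> set xs - set (take m xs)" for A C
    using that * asym X by blast
  show "card (set (take m xs)) = m"
    using assms(2,3) by (simp add: distinct_card)
qed (use irrefl in \<open>auto dest: in_set_takeD\<close>)

section \<open>Lex order on 3-sets through increasing triples\<close>

lemma lex_lessI:
  assumes "finite A" "finite B" "k \<in> A" "k \<notin> B" "\<And>i. i < k \<Longrightarrow> i \<in> A \<longleftrightarrow> i \<in> B"
  shows "lex_less A B"
proof -
  have "Min ((A - B) \<union> (B - A)) = k"
    using assms by (intro Min_eqI) (auto simp: not_less[symmetric])
  then show ?thesis
    using assms by (auto simp: lex_less_def)
qed

lemma lex_less_irrefl: "\<not> lex_less A A"
  by (simp add: lex_less_def)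

text \<open>The symmetric difference is the same for both orders of the arguments, and its minimum
  lies in only one of the two sets. Finiteness ensures that \<open>Min\<close> is a genuine
  element.\<close>

lemma lex_less_asym:
  assumes "finite A" "finite B" "lex_less A B"
  shows "\<not> lex_less B A"
proof -
  have "Min ((A - B) \<union> (B - A)) \<in> (A - B) \<union> (B - A)"
    using assms by (intro Min_in) (auto simp: lex_less_def)
  then show ?thesis
    using assms(3) by (auto simp: lex_less_def Un_commute)
qed

fun edge :: "nat \<times> nat \<times> nat \<Rightarrow> nat set" where
  "edge (a, b, c) = {a, b, c}"

fun incr :: "nat \<times> nat \<times> nat \<Rightarrow> bool" where
  "incr (a, b, c) \<longleftrightarrow> a < b \<and> b < c"

fun triple_less :: "nat \<times> nat \<times> nat \<Rightarrow> nat \<times> nat \<times> nat \<Rightarrow> bool" where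
  "triple_less (a, b, c) (d, e, f) \<longleftrightarrow> a < d \<or> a = d \<and> (b < e \<or> b = e \<and> c < f)"

lemma finite_edge [simp]: "finite (edge t)"
  by (cases t) simp

text \<open>At the first coordinate where the triples differ, the smaller entry is the least element
  of the symmetric difference: as the triples increase, all smaller vertices are shared.\<close>

lemma lex_less_edge:
  assumes "incr s" "incr t" "triple_less s t"
  shows "lex_less (edge s) (edge t)"
proof -
  obtain a b c d e f where st: "s = (a, b, c)" "t = (d, e, f)"
    by (metis prod_cases3)
  consider "a < d" | "a = d" "b < e" | "a = d" "b = e" "c < f"
    using assms(3) st by auto
  then show ?thesis
  proof cases
    case 1
    then show ?thesis
      using assms st by (intro lex_lessI[where k = a]) auto
  next
    case 2
    then show ?thesis
      using assms st by (intro lex_lessI[where k = b]) auto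
  next
    case 3
    then show ?thesis
      using assms st by (intro lex_lessI[where k = c]) auto
  qed
qed

text \<open>Distinct triples are comparable under \<open>triple_less\<close>, so their edges are
  comparable under the irreflexive \<open>lex_less\<close> and hence differ.\<close>

lemma inj_on_edge: "inj_on edge (Collect incr)"
proof (rule inj_onI)
  fix s t assume "s \<in> Collect incr" "t \<in> Collect incr" and eq: "edge s = edge t"
  moreover have "triple_less s t \<or> s = t \<or> triple_less t s"
    by (cases s; cases t) auto
  ultimately show "s = t"
    using lex_less_edge lex_less_irrefl by (metis mem_Collect_eq)
qed

lemma nsets_3_eq_edge:
  fixes X :: "nat set"
  shows "nsets X 3 = edge ` {t. incr t \<and> edge t \<subseteq> X}"
proof (rule set_eqI)
  fix A
  show "A \<in> nsets X 3 \<longleftrightarrow> A \<in> edge ` {t. incr t \<and> edge t \<subseteq> X}"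
  proof
    assume A: "A \<in> nsets X 3"
    then have c: "card A = 3" and fin: "finite A" and sub: "A \<subseteq> X"
      by (auto simp: nsets_def)
    define xs where "xs = sorted_list_of_set A"
    have xs: "sorted_wrt (<) xs" "length xs = 3" "set xs = A"
      using c fin by (simp_all add: xs_def)
    then obtain a b d where "xs = [a, b, d]"
      by (auto simp: numeral_3_eq_3 length_Suc_conv)
    then show "A \<in> edge ` {t. incr t \<and> edge t \<subseteq> X}"
      using xs sub by (intro image_eqI[where x = "(a, b, d)"]) auto
  next
    assume "A \<in> edge ` {t. incr t \<and> edge t \<subseteq> X}"
    then show "A \<in> nsets X 3"
      by (auto simp: nsets_def)
  qed
qed

section \<open>Lex families on seven vertices\<close>

definition triples :: "nat \<Rightarrow> (nat \<times> nat \<times> nat) list" where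
  "triples n = [(a, b, c). a \<leftarrow> [1..<Suc n], b \<leftarrow> [Suc a..<Suc n], c \<leftarrow> [Suc b..<Suc n]]"

lemma set_triples: "set (triples n) = {t. incr t \<and> edge t \<subseteq> {1..n}}"
proof (rule set_eqI)
  fix t :: "nat \<times> nat \<times> nat"
  obtain a b c where t: "t = (a, b, c)"
    by (metis prod_cases3)
  have "t \<in> set (triples n) \<longleftrightarrow> a \<in> {1..<Suc n} \<and> b \<in> {Suc a..<Suc n} \<and> c \<in> {Suc b..<Suc n}"
    by (simp add: triples_def t image_iff del: upt_Suc)
  then show "t \<in> set (triples n) \<longleftrightarrow> t \<in> {t. incr t \<and> edge t \<subseteq> {1..n}}"
    by (auto simp: t)
qed

lemma nsets_triples: "nsets {1..n} 3 = set (map edge (triples n))"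
  by (simp add: nsets_3_eq_edge set_triples)

lemma distinct_map_edge:
  assumes "\<forall>t\<in>set ts. incr t" "distinct ts"
  shows "distinct (map edge ts)"
  using assms by (auto simp: distinct_map intro: inj_on_subset[OF inj_on_edge])

text \<open>The nested generators of \<open>triples\<close> run in lexicographic order, so the lex
  families are prefixes. The bound 35 is 7 choose 3.\<close>

lemma lex_family_7_3:
  assumes "m \<le> 35"
  shows "lex_family m 7 3 = set (map edge (take m (triples 7)))"
proof -
  have inc: "\<forall>t\<in>set (triples 7). incr t"
    by (simp add: set_triples)
  have "sorted_wrt triple_less (triples 7)"
    by code_simp
  then have "sorted_wrt lex_less (map edge (triples 7))"
    unfolding sorted_wrt_map by (rule sorted_wrt_mono_rel[rotated]) (use inc lex_less_edge in blast)
  moreover have "distinct (map edge (triples 7))"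
    using inc by (rule distinct_map_edge) code_simp
  moreover have "length (triples 7) = 35"
    by code_simp
  moreover have "finite A" if "A \<in> set (map edge (triples 7))" for A
    using that by auto
  ultimately have "first_sets lex_less (set (map edge (triples 7))) m
      = set (take m (map edge (triples 7)))"
    using assms lex_less_asym lex_less_irrefl
    by (intro first_sets_sorted) (simp_all only: length_map, blast+)
  then show ?thesis
    by (simp only: lex_family_def nsets_triples take_map)
qed

text \<open>Reduces \<open>P2\<close> to a finite list computation. Injectivity of
  \<open>edge\<close> lets triples be counted in place of edges, and \<open>vs\<close> may contain
  isolated vertices, since they contribute 0.\<close>

lemma P2_edges:
  assumes "\<forall>t\<in>set ts. incr t" "distinct ts" "\<forall>t\<in>set ts. edge t \<subseteq> set vs" "distinct vs"
  shows "P2 (set (map edge ts)) = (\<Sum>x\<leftarrow>vs. (length (filter (\<lambda>t. x \<in> edge t) ts))\<^sup>2)"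
proof -
  let ?F = "set (map edge ts)"
  have deg: "deg ?F x = length (filter (\<lambda>t. x \<in> edge t) ts)" for x
  proof -
    have "{e \<in> ?F. x \<in> e} = set (map edge (filter (\<lambda>t. x \<in> edge t) ts))"
      by auto
    moreover have "distinct (map edge (filter (\<lambda>t. x \<in> edge t) ts))"
      using assms(1,2) by (intro distinct_map_edge) auto
    ultimately show ?thesis
      unfolding deg_def by (simp only: distinct_card length_map)
  qed
  have "P2 ?F = (\<Sum>x\<in>set vs. (deg ?F x)\<^sup>2)"
    unfolding P2_def
  proof (rule sum.mono_neutral_left)
    show "\<forall>x\<in>set vs - \<Union> ?F. (deg ?F x)\<^sup>2 = 0"
      unfolding deg by (auto simp: filter_empty_conv)
  qed (use assms(3) in auto)
  also have "\<dots> = (\<Sum>x\<leftarrow>vs. (deg ?F x)\<^sup>2)"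
    using assms(4) by (simp add: sum_list_distinct_conv_sum_set)
  finally show ?thesis
    unfolding deg .
qed

section \<open>The graph \<open>H\<close> and the two lex examples\<close>

definition H_triples :: "(nat \<times> nat \<times> nat) list" where
  "H_triples = [(1,2,3), (1,2,4), (1,2,5), (1,2,6), (1,2,7), (1,3,4), (1,3,5), (1,3,6),
     (1,4,5), (1,4,6), (1,5,6)]"

lemma H_eq: "H = set (map edge H_triples)"
  by (simp add: H_def H_triples_def)

lemma H_subset: "H \<subseteq> nsets {1..7} 3"
proof -
  have "set H_triples \<subseteq> set (triples 7)"
    by code_simp
  then show ?thesis
    unfolding H_eq nsets_triples by auto
qed

lemma card_edges:
  assumes "\<forall>t\<in>set ts. incr t" "distinct ts"
  shows "card (set (map edge ts)) = length ts"
  using distinct_card[OF distinct_map_edge[OF assms]] by simp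

lemma card_H: "card H = 11"
  unfolding H_eq by (subst card_edges; code_simp)

lemma P2_H: "P2 H = 211"
  unfolding H_eq by (subst P2_edges[where vs = "[1,2,3,4,5,6,7]"]; code_simp)

lemma P2_lex: "P2 (lex_family 11 7 3) = 209"
proof -
  have *: "lex_family 11 7 3 = set (map edge (take 11 (triples 7)))"
    by (rule lex_family_7_3) simp
  show ?thesis
    unfolding * by (subst P2_edges[where vs = "[1,2,3,4,5,6,7]"]; code_simp)
qed

text \<open>Removing a prefix from a repetition-free list leaves its suffix, here the last 35 - 24 =
  11 triples: 267 and all triples in {3,...,7}.\<close>

lemma lex_complement:
  "nsets {1..7} 3 - lex_family 24 7 3 = set (map edge (drop 24 (triples 7)))"
proof -
  have "distinct (map edge (triples 7))"
    by (rule distinct_map_edge; code_simp)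
  moreover have "set (xs :: nat set list) - set (take k xs) = set (drop k xs)" if "distinct xs" for xs k
    using set_take_disj_set_drop_if_distinct[OF that, of k k]
    by (metis Diff_cancel Diff_triv Un_Diff Int_commute append_take_drop_id le_refl set_append
        sup_bot_left)
  moreover have "lex_family 24 7 3 = set (map edge (take 24 (triples 7)))"
    by (rule lex_family_7_3) simp
  ultimately show ?thesis
    by (simp only: nsets_triples flip: take_map drop_map)
qed

lemma card_lex_complement: "card (nsets {1..7} 3 - lex_family 24 7 3) = 11"
  unfolding lex_complement by (subst card_edges; code_simp)

lemma P2_lex_complement: "P2 (nsets {1..7} 3 - lex_family 24 7 3) = 207"
  unfolding lex_complement
  by (subst P2_edges[where vs = "[1,2,3,4,5,6,7]"]; code_simp)

section \<open>The colex family\<close>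

definition colex_triples :: "(nat \<times> nat \<times> nat) list" where
  "colex_triples = [(1,2,3), (1,2,4), (1,3,4), (2,3,4), (1,2,5), (1,3,5), (2,3,5), (1,4,5),
     (2,4,5), (3,4,5), (1,2,6)]"

text \<open>Provides the finiteness needed for initial segments of an infinite ground set: every
  element i of a predecessor \<open>B\<close> satisfies i < 2^i, which is at most the weight of
  \<open>B\<close> and so below that of \<open>C\<close>.\<close>

lemma finite_colex_predecessors: "finite {B \<in> nsets X r. colex_less B C}"
proof (rule finite_subset)
  let ?w = "\<Sum>i\<in>C. (2::nat) ^ i"
  have "B \<subseteq> {..<?w}" if "finite B" "colex_less B C" for B
  proof
    fix i assume "i \<in> B"
    then have "2 ^ i \<le> (\<Sum>i\<in>B. (2::nat) ^ i)"
      using that(1) by (intro member_le_sum) auto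
    moreover have "i < 2 ^ i"
      by (rule less_exp)
    ultimately show "i \<in> {..<?w}"
      using that(2) unfolding colex_less_def lessThan_iff by linarith
  qed
  then show "{B \<in> nsets X r. colex_less B C} \<subseteq> Pow {..<?w}"
    by (auto simp: nsets_def)
qed simp

lemma colex_weight_gt:
  assumes "incr t" "edge t \<subseteq> {1..}" "t \<notin> set colex_triples"
  shows "70 < (\<Sum>i\<in>edge t. (2::nat) ^ i)"
proof -
  obtain a b c where t: "t = (a, b, c)"
    by (metis prod_cases3)
  have ord: "1 \<le> a" "a < b" "b < c"
    using assms(1,2) t by auto
  have w: "(\<Sum>i\<in>edge t. (2::nat) ^ i) = 2 ^ a + 2 ^ b + 2 ^ c"
    using ord t by simp
  \<comment> \<open>A triple with largest entry at most 5 lies in \<open>triples 5\<close>, all of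
    which is listed.\<close>
  have "6 \<le> c"
  proof (rule ccontr)
    assume "\<not> 6 \<le> c"
    then have "t \<in> set (triples 5)"
      using assms(1,2) t by (auto simp: set_triples)
    moreover have "set (triples 5) \<subseteq> set colex_triples"
      by code_simp
    ultimately show False
      using assms(3) by blast
  qed
  \<comment> \<open>With \<open>c = 6\<close>, the value \<open>b = 2\<close> would force
    \<open>a = 1\<close> and give the listed triple 126. The two remaining cases have weight above
    2^7 = 128 and above 2^6 + 2^3 = 72.\<close>
  then consider "7 \<le> c" | "c = 6" "3 \<le> b"
  proof -
    have "\<not> (a = 1 \<and> b = 2 \<and> c = 6)"
      using assms(3) t by (auto simp: colex_triples_def)
    then show ?thesis
      using that ord \<open>6 \<le> c\<close> by linarith
  qed
  then show ?thesis
  proof cases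
    case 1
    then have "(2::nat) ^ 7 \<le> 2 ^ c"
      by (intro power_increasing) auto
    then show ?thesis
      unfolding w by simp
  next
    case 2
    then have "(2::nat) ^ 3 \<le> 2 ^ b"
      by (intro power_increasing) auto
    then show ?thesis
      unfolding w using 2 by simp
  qed
qed

lemma colex_family_11_3: "colex_family 11 3 = set (map edge colex_triples)"
  unfolding colex_family_def
proof (rule first_sets_eqI)
  have inc: "\<forall>t\<in>set colex_triples. incr t \<and> edge t \<subseteq> {1..}"
    by (simp add: colex_triples_def)
  then show "set (map edge colex_triples) \<subseteq> nsets {1..} 3"
    by (auto simp: nsets_3_eq_edge)
  show "card (set (map edge colex_triples)) = 11"
    by (subst card_edges; code_simp)
  fix A C
  assume A: "A \<in> set (map edge colex_triples)"
    and C: "C \<in> nsets {1..} 3 - set (map edge colex_triples)"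
  have "\<forall>t\<in>set colex_triples. (\<Sum>i\<in>edge t. (2::nat) ^ i) \<le> 70"
    by (simp add: colex_triples_def)
  then have "(\<Sum>i\<in>A. (2::nat) ^ i) \<le> 70"
    using A by auto
  moreover have "70 < (\<Sum>i\<in>C. (2::nat) ^ i)"
    using C colex_weight_gt by (auto simp: nsets_3_eq_edge)
  ultimately show "colex_less A C \<and> \<not> colex_less C A"
    by (simp add: colex_less_def)
qed (simp_all add: finite_colex_predecessors, simp add: colex_less_def)

text \<open>The degrees are 7,7,6,6,6,1. The value agrees with that of the lex complement because
  the reflection i -> 8 - i carries one 3-graph to the other.\<close>

lemma P2_colex: "P2 (colex_family 11 3) = 207"
  unfolding colex_family_11_3
  by (subst P2_edges[where vs = "[1,2,3,4,5,6]"]; code_simp)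

text \<open>The guard \<open>m \<le> t choose r\<close> keeps the refutation meaningful: beyond it
  no r-graph with \<open>m\<close> edges fits in [t], so no family could satisfy
  \<open>is_arg_max\<close>.\<close>

theorem mainTheorem4:
  shows "H \<subseteq> nsets {1..7} 3 \<and> card H = 11 \<and> P2 H = 211
    \<and> P2 (lex_family 11 7 3) \<le> 209
    \<and> card (nsets {1..7} 3 - lex_family 24 7 3) = 11
    \<and> P2 (nsets {1..7} 3 - lex_family 24 7 3) \<le> 209
    \<and> P2 (colex_family 11 3) \<le> 209
    \<and> \<not> (\<forall>r m t. m \<le> t choose r \<longrightarrow>
          is_arg_max P2 (\<lambda>F. rgraph r F \<and> F \<subseteq> nsets {1..t} r \<and> card F = m) (lex_family m t r)
        \<or> is_arg_max P2 (\<lambda>F. rgraph r F \<and> F \<subseteq> nsets {1..t} r \<and> card F = m) (colex_family m r))"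
proof -
  let ?P = "\<lambda>F. rgraph 3 F \<and> F \<subseteq> nsets {1..7} 3 \<and> card F = 11"
  have "nsets {1..7} 3 \<subseteq> nsets {1::nat..} 3"
    by (intro nsets_mono) auto
  then have "?P H"
    using H_subset card_H by (auto simp: rgraph_def H_def)
  \<comment> \<open>\<open>H\<close> is an admissible competitor with value 211, so nothing of value
    at most 209 is maximal.\<close>
  then have "\<not> is_arg_max P2 ?P F" if "P2 F \<le> 209" for F
    using that P2_H unfolding is_arg_max_def by fastforce
  then have "\<not> (is_arg_max P2 ?P (lex_family 11 7 3) \<or> is_arg_max P2 ?P (colex_family 11 3))"
    using P2_lex P2_colex by simp
  moreover have "11 \<le> 7 choose (3::nat)"
    by (simp add: eval_nat_numeral)
  ultimately have "\<not> (\<forall>r m t. m \<le> t choose r \<longrightarrow>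
          is_arg_max P2 (\<lambda>F. rgraph r F \<and> F \<subseteq> nsets {1..t} r \<and> card F = m) (lex_family m t r)
        \<or> is_arg_max P2 (\<lambda>F. rgraph r F \<and> F \<subseteq> nsets {1..t} r \<and> card F = m) (colex_family m r))"
    by blast
  then show ?thesis
    using H_subset card_H P2_H P2_lex card_lex_complement P2_lex_complement P2_colex by simp
qed

end
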